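(* Let $a,b$ be positive integers and let $(x_0,y_0),(x_1,y_1),\dots$ be the P-positions $(x,y)$ of $\mathrm{WYT}(a,b)$ with $x\le y$, listed so that $x_0<x_1<\cdots$. Then $\mathcal{R}(x_m,y_m)=2m$ for all $m\in\mathbb{Z}_+$.
   Context: Game $\mathrm{WYT}(a,b)$: positions are pairs $(x,y)$ of nonnegative integers; a move replaces $(x,y)$ by $(x-\epsilon,y-\delta)$ where $0\le\epsilon\le x$, $0\le\delta\le y$, $\epsilon+\delta>0$, and $|\epsilon-\delta|<a$ or $\min(\epsilon,\delta)<b$ (or both). A player unable to move loses. P-positions are those from which the player to move loses under optimal play. For each P-position with $x\le y$ the first coordinates are distinct and $(x_0,y_0)=(0,0)$. Remoteness function: $\mathcal{R}(p)=0$ if $p$ is terminal; otherwise, if some move $p\to q$ has $\mathcal{R}(q)$ even, $\mathcal{R}(p)=1+\min\{\mathcal{R}(q): p\to q,\ \mathcal{R}(q)\text{ even}\}$, else $\mathcal{R}(p)=1+\max\{\mathcal{R}(q): p\to q\}$. *)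

theory Defs
  imports "HOL-Library.Infinite_Set"
begin

definition wyt_moves :: "nat \<Rightarrow> nat \<Rightarrow> nat \<times> nat \<Rightarrow> (nat \<times> nat) set" where
  "wyt_moves a b = (\<lambda>(x, y). {(x - e, y - d) | e d.
     e \<le> x \<and> d \<le> y \<and> e + d > 0 \<and> (\<bar>int e - int d\<bar> < int a \<or> min e d < b)})"

lemma wyt_moves_sum_less:
  assumes "q \<in> wyt_moves a b p"
  shows "fst q + snd q < fst p + snd p"
  using assms by (auto simp: wyt_moves_def split: prod.splits)

lemma wyt_moves_iff:
  "(s, t) \<in> wyt_moves a b (x, y) \<longleftrightarrow> s \<le> x \<and> t \<le> y \<and> s + t < x + y \<and>
    (\<bar>int (x - s) - int (y - t)\<bar> < int a \<or> min (x - s) (y - t) < b)"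
proof
  assume "(s, t) \<in> wyt_moves a b (x, y)"
  then show "s \<le> x \<and> t \<le> y \<and> s + t < x + y \<and>
    (\<bar>int (x - s) - int (y - t)\<bar> < int a \<or> min (x - s) (y - t) < b)"
    unfolding wyt_moves_def by auto
next
  assume "s \<le> x \<and> t \<le> y \<and> s + t < x + y \<and>
    (\<bar>int (x - s) - int (y - t)\<bar> < int a \<or> min (x - s) (y - t) < b)"
  then show "(s, t) \<in> wyt_moves a b (x, y)"
    unfolding wyt_moves_def prod.case mem_Collect_eq
    by (intro exI[of _ "x - s"] exI[of _ "y - t"]) auto
qed

lemma finite_wyt_moves: "finite (wyt_moves a b p)"
  by (rule finite_subset[of _ "{..fst p} \<times> {..snd p}"])
    (auto simp: wyt_moves_def split: prod.splits)

(* Outcome under optimal play: the player to move wins iff some move leaves the opponent in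
   a losing position, and loses iff every move (possibly none) leaves the opponent in a
   winning position. *)
inductive mover_wins :: "nat \<Rightarrow> nat \<Rightarrow> nat \<times> nat \<Rightarrow> bool"
  and mover_loses :: "nat \<Rightarrow> nat \<Rightarrow> nat \<times> nat \<Rightarrow> bool"
  for a b :: nat where
  "q \<in> wyt_moves a b p \<Longrightarrow> mover_loses a b q \<Longrightarrow> mover_wins a b p"
| "(\<And>q. q \<in> wyt_moves a b p \<Longrightarrow> mover_wins a b q) \<Longrightarrow> mover_loses a b p"

definition P_positions :: "nat \<Rightarrow> nat \<Rightarrow> (nat \<times> nat) set" where
  "P_positions a b = {p. mover_loses a b p}"

context
  notes conj_cong [fundef_cong]
begin

function remoteness :: "nat \<Rightarrow> nat \<Rightarrow> nat \<times> nat \<Rightarrow> nat" where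
  "remoteness a b p =
    (if wyt_moves a b p = {} then 0
     else if \<exists>q \<in> wyt_moves a b p. even (remoteness a b q)
     then 1 + Min (remoteness a b ` {q \<in> wyt_moves a b p. even (remoteness a b q)})
     else 1 + Max (remoteness a b ` wyt_moves a b p))"
  by auto
termination
  by (relation "measure (\<lambda>(a, b, p). fst p + snd p)")
    (auto dest: wyt_moves_sum_less)

end

declare remoteness.simps [simp del]

lemma mover_loses_or_wins: "mover_loses a b p \<or> mover_wins a b p"
proof (induction "fst p + snd p" arbitrary: p rule: less_induct)
  case less
  then show ?case
    by (metis mover_wins_mover_loses.intros wyt_moves_sum_less)
qed

lemma mover_wins_not_loses: "mover_wins a b p \<Longrightarrow> \<not> mover_loses a b p"
proof (induction "fst p + snd p" arbitrary: p rule: less_induct)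
  case less
  from less.prems obtain q where "q \<in> wyt_moves a b p" "mover_loses a b q"
    by (auto elim: mover_wins.cases)
  with less.hyps show ?case
    by (metis mover_loses.cases wyt_moves_sum_less)
qed

lemma P_positions_iff:
  "p \<in> P_positions a b \<longleftrightarrow> (\<forall>q \<in> wyt_moves a b p. q \<notin> P_positions a b)"
proof
  assume "p \<in> P_positions a b"
  then show "\<forall>q \<in> wyt_moves a b p. q \<notin> P_positions a b"
    unfolding P_positions_def by (metis mem_Collect_eq mover_loses.cases mover_wins_not_loses)
next
  assume "\<forall>q \<in> wyt_moves a b p. q \<notin> P_positions a b"
  then show "p \<in> P_positions a b"
    unfolding P_positions_def using mover_loses_or_wins mover_wins_mover_loses.intros(2) by blast
qed

lemma P_position_fst_inj:
  assumes "b > 0" "(u, v) \<in> P_positions a b" "(u, w) \<in> P_positions a b"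
  shows "v = w"
proof -
  have False if "v' < w'" "(u, v') \<in> P_positions a b" "(u, w') \<in> P_positions a b" for v' w'
  proof -
    have "(u, v') \<in> wyt_moves a b (u, w')"
      using that(1) \<open>b > 0\<close>
      by (simp add: wyt_moves_iff)
    then show False using that P_positions_iff by blast
  qed
  then show ?thesis using assms by (meson nat_neq_iff)
qed

lemma infinite_P_positions: "infinite {(u, v). (u, v) \<in> P_positions a b \<and> u \<le> v}" (is "infinite ?S")
proof
  assume "finite ?S"
  then have "finite (fst ` ?S \<union> snd ` ?S)" by simp
  then obtain N where "\<forall>n \<in> fst ` ?S \<union> snd ` ?S. n \<le> N"
    using finite_nat_set_iff_bounded_le by blast
  then have N: "u \<le> N \<and> v \<le> N" if "(u, v) \<in> P_positions a b" "u \<le> v" for u v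
    using that by force
  have sym: "(v, u) \<in> P_positions a b" if "(u, v) \<in> P_positions a b" for u v
    using that
  proof (induction "u + v" arbitrary: u v rule: less_induct)
    case less
    have "q \<notin> P_positions a b" if q: "q \<in> wyt_moves a b (v, u)" for q
    proof
      assume P: "q \<in> P_positions a b"
      obtain s t where st: "q = (s, t)" by force
      have "(t, s) \<in> wyt_moves a b (u, v)"
        using q unfolding st wyt_moves_iff
        by (metis min.commute abs_minus_commute add.commute)
      moreover have "(t, s) \<in> P_positions a b"
        using less.hyps[of s t] wyt_moves_sum_less[OF q] P by (simp add: st add.commute)
      ultimately show False using less.prems P_positions_iff by blast
    qed
    then show ?case using P_positions_iff by blast
  qed
  have N': "u \<le> N \<and> v \<le> N" if "(u, v) \<in> P_positions a b" for u v
    using that N[of u v] N[of v u] sym[of u v] by linarith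
  let ?p = "(N + b + 1, 2 * N + a + b + 1)"
  have "q \<notin> P_positions a b" if "q \<in> wyt_moves a b ?p" for q
  proof
    assume "q \<in> P_positions a b"
    moreover obtain s t where st: "q = (s, t)" by force
    ultimately have "s \<le> N" "t \<le> N" using N' by auto
    then have "int (2 * N + a + b + 1 - t) - int (N + b + 1 - s) \<ge> int a"
      "N + b + 1 - s \<ge> b" "2 * N + a + b + 1 - t \<ge> b"
      by linarith+
    then show False using that unfolding st wyt_moves_iff by auto
  qed
  then have "?p \<in> P_positions a b" using P_positions_iff by blast
  then show False using N'[of "N + b + 1" "2 * N + a + b + 1"] by simp
qed

(* The P-positions (u, v) with u \<le> v can be listed as an infinite sequence with strictly
   increasing first coordinates, so hypotheses of this form are satisfiable. *)
lemma P_positions_enumeration_exists: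
  assumes "b > 0"
  shows "\<exists>x y :: nat \<Rightarrow> nat. strict_mono x \<and>
    {(x m, y m) | m. True} = {(u, v). (u, v) \<in> P_positions a b \<and> u \<le> v}"
proof -
  let ?S = "{(u, v). (u, v) \<in> P_positions a b \<and> u \<le> v}"
  have "inj_on fst ?S"
    using P_position_fst_inj[OF assms] by (auto simp: inj_on_def)
  then have inf: "infinite (fst ` ?S)"
    using infinite_P_positions finite_imageD by blast
  define x where "x = enumerate (fst ` ?S)"
  have x: "strict_mono x" "range x = fst ` ?S"
    unfolding x_def using inf by (auto simp: strict_mono_enumerate range_enumerate)
  have "\<forall>m. \<exists>w. (x m, w) \<in> ?S"
  proof
    fix m
    have "x m \<in> fst ` ?S" using x(2) by blast
    then show "\<exists>w. (x m, w) \<in> ?S" by force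
  qed
  then have "\<exists>y. \<forall>m. (x m, y m) \<in> ?S" by (rule choice)
  then obtain y where "\<forall>m. (x m, y m) \<in> ?S" by (rule exE)
  then have y: "(x m, y m) \<in> ?S" for m by (rule spec)
  have "{(x m, y m) | m. True} = ?S"
  proof
    show "{(x m, y m) | m. True} \<subseteq> ?S" using y by blast
    show "?S \<subseteq> {(x m, y m) | m. True}"
    proof
      fix p assume p: "p \<in> ?S"
      then have "fst p \<in> range x" unfolding x(2) by (rule imageI)
      then obtain m where m: "fst p = x m" by (rule rangeE)
      have "snd p = y m"
        using P_position_fst_inj[OF assms, of "x m" "snd p" a "y m"] y[of m] p m
        by (cases p) simp
      with m have "p = (x m, y m)" by (simp add: prod_eq_iff)
      then show "p \<in> {(x m, y m) | m. True}" by blast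
    qed
  qed
  with x(1) show ?thesis by (intro exI[of _ x] exI[of _ y] conjI)
qed

end

theory Submission
  imports Defs
begin

text \<open>
  Write the listed P-positions as \<open>p m = (x m, y m)\<close>. First, \<open>y m = x m + a * m\<close>. If the difference
  \<open>y m - x m\<close> were below \<open>a * m\<close>, then \<open>p m\<close> could move to \<open>p i\<close> with \<open>i = (y m - x m) div a\<close>. If it
  were above, then \<open>(x m, x m + a * m)\<close> would be an N-position, and a move from it to a P-position,
  which has to lower the first coordinate by less than \<open>b\<close>, would also be available from \<open>p m\<close>.

  Every move from \<open>p m\<close> can be answered by a move to some \<open>p i\<close> or its mirror image with \<open>i < m\<close>, so
  the remoteness grows by at most two at each step. Moving to \<open>(x (m - 1), y (m - 1) + 1)\<close> is
  optimal for the loser: it is a legal move since the decrements differ by \<open>a - 1\<close>, and the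
  only P-position within reach from there is \<open>p (m - 1)\<close>.
\<close>

section \<open>Mirror symmetry of the game and parity of the remoteness\<close>

lemma wyt_moves_swap:
  "prod.swap q \<in> wyt_moves a b (prod.swap p) \<longleftrightarrow> q \<in> wyt_moves a b p"
  by (cases p; cases q) (simp add: wyt_moves_iff min.commute abs_minus_commute add.commute conj_ac)

lemma wyt_moves_swap_image: "wyt_moves a b (prod.swap p) = prod.swap ` wyt_moves a b p"
proof (rule set_eqI)
  fix q
  show "q \<in> wyt_moves a b (prod.swap p) \<longleftrightarrow> q \<in> prod.swap ` wyt_moves a b p"
    using wyt_moves_swap[of "prod.swap q" a b p] by (auto simp: image_iff) (metis swap_swap)
qed

lemma P_positions_swap: "prod.swap p \<in> P_positions a b \<longleftrightarrow> p \<in> P_positions a b"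
proof (induction "fst p + snd p" arbitrary: p rule: less_induct)
  case less
  have "prod.swap p \<in> P_positions a b \<longleftrightarrow> (\<forall>q \<in> wyt_moves a b p. prod.swap q \<notin> P_positions a b)"
    by (subst P_positions_iff) (simp add: wyt_moves_swap_image)
  also have "\<dots> \<longleftrightarrow> (\<forall>q \<in> wyt_moves a b p. q \<notin> P_positions a b)"
    using less wyt_moves_sum_less by blast
  also have "\<dots> \<longleftrightarrow> p \<in> P_positions a b" by (rule P_positions_iff[symmetric])
  finally show ?case .
qed

text \<open>An option with even remoteness makes the value odd; without one it is 0 or one more than
  an odd maximum. So parity obeys the same recursion as \<open>P_positions_iff\<close>.\<close>

lemma even_remoteness_iff: "even (remoteness a b p) \<longleftrightarrow> p \<in> P_positions a b"
proof (induction "fst p + snd p" arbitrary: p rule: less_induct)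
  case less
  let ?M = "wyt_moves a b p" and ?R = "remoteness a b"
  let ?E = "{q \<in> ?M. even (?R q)}"
  have fin: "finite ?M" by (rule finite_wyt_moves)
  have "even (?R p) \<longleftrightarrow> (\<forall>q \<in> ?M. odd (?R q))"
  proof (cases "\<exists>q \<in> ?M. even (?R q)")
    case True
    then have "Min (?R ` ?E) \<in> ?R ` ?E" using fin by (intro Min_in) auto
    then have "odd (?R p)" using True by (subst remoteness.simps) auto
    with True show ?thesis by blast
  next
    case False
    have "even (?R p)"
    proof (cases "?M = {}")
      case True
      then show ?thesis by (subst remoteness.simps) simp
    next
      case ne: False
      then have "Max (?R ` ?M) \<in> ?R ` ?M" using fin by (intro Max_in) auto
      then show ?thesis using False ne by (subst remoteness.simps) auto
    qed
    with False show ?thesis by blast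
  qed
  also have "\<dots> \<longleftrightarrow> p \<in> P_positions a b"
    using less wyt_moves_sum_less P_positions_iff by blast
  finally show ?case .
qed

text \<open>Parity being known, the case split of the recursion becomes membership in
  \<open>P_positions\<close>. The second assumption excludes terminal positions, whose value is
  0.\<close>

lemma remoteness_P_position:
  assumes "p \<in> P_positions a b" "wyt_moves a b p \<noteq> {}"
  shows "remoteness a b p = 1 + Max (remoteness a b ` wyt_moves a b p)"
  using assms P_positions_iff[of p a b] by (subst remoteness.simps) (simp add: even_remoteness_iff)

lemma remoteness_N_position:
  assumes "p \<notin> P_positions a b"
  shows "remoteness a b p = 1 + Min (remoteness a b ` (wyt_moves a b p \<inter> P_positions a b))"
proof -
  have "{q \<in> wyt_moves a b p. even (remoteness a b q)} = wyt_moves a b p \<inter> P_positions a b"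
    by (auto simp: even_remoteness_iff)
  then show ?thesis
    using assms P_positions_iff[of p a b] by (subst remoteness.simps) (auto simp: even_remoteness_iff)
qed

text \<open>Swapping carries options to options and P-positions to P-positions, so
  \<open>Min\<close> and \<open>Max\<close> range over the same values. This transfers the
  remoteness of listed positions to their mirror images.\<close>

lemma remoteness_swap: "remoteness a b (prod.swap p) = remoteness a b p"
proof (induction "fst p + snd p" arbitrary: p rule: less_induct)
  case less
  have IH: "remoteness a b (prod.swap q) = remoteness a b q" if "q \<in> wyt_moves a b p" for q
    using less wyt_moves_sum_less[OF that] by blast
  show ?case
  proof (cases "p \<in> P_positions a b")
    case True
    show ?thesis
    proof (cases "wyt_moves a b p = {}")
      case True
      then show ?thesis
        by (simp add: remoteness.simps[of a b p] remoteness.simps[of a b "prod.swap p"]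
            wyt_moves_swap_image)
    next
      case False
      have "remoteness a b ` wyt_moves a b (prod.swap p) = remoteness a b ` wyt_moves a b p"
        unfolding wyt_moves_swap_image image_image using IH by (rule image_cong[OF refl])
      then show ?thesis
        using True False by (simp add: remoteness_P_position P_positions_swap wyt_moves_swap_image)
    qed
  next
    case False
    have "wyt_moves a b (prod.swap p) \<inter> P_positions a b
        = prod.swap ` (wyt_moves a b p \<inter> P_positions a b)"
      unfolding wyt_moves_swap_image using P_positions_swap by auto
    then have "remoteness a b ` (wyt_moves a b (prod.swap p) \<inter> P_positions a b)
        = remoteness a b ` (wyt_moves a b p \<inter> P_positions a b)"
      using IH by (simp only: image_image) (rule image_cong[OF refl], simp)
    then show ?thesis using False by (simp add: remoteness_N_position P_positions_swap)
  qed
qed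

section \<open>Coordinates of the listed P-positions\<close>

lemma P_positions_no_move:
  assumes "(u, v) \<in> P_positions a b" "(s, t) \<in> P_positions a b" "s \<le> u" "t \<le> v" "s + t < u + v"
  shows "int a \<le> \<bar>int (u - s) - int (v - t)\<bar>" "b \<le> u - s"
proof -
  have "(s, t) \<notin> wyt_moves a b (u, v)" using assms P_positions_iff by blast
  with assms show "int a \<le> \<bar>int (u - s) - int (v - t)\<bar>" "b \<le> u - s"
    unfolding wyt_moves_iff by auto
qed

text \<open>Indexes an arbitrary P-position by the listing. The strict inequality in
  \<open>lower\<close> will turn a bound on the larger coordinate \<open>u\<close> into a bound on
  the index \<open>i\<close>.\<close>

lemma P_positions_cases:
  fixes x y :: "nat \<Rightarrow> nat"
  assumes enum: "{(x m, y m) | m. True} = {(u, v). (u, v) \<in> P_positions a b \<and> u \<le> v}"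
    and P: "(u, v) \<in> P_positions a b"
  obtains (upper) i where "u = x i" "v = y i"
  | (lower) i where "u = y i" "v = x i" "x i < y i"
proof (cases "u \<le> v")
  case True
  then have "(u, v) \<in> {(x m, y m) | m. True}" unfolding enum using P by simp
  then show thesis using upper by blast
next
  case False
  have "(v, u) \<in> P_positions a b" using P P_positions_swap[of "(u, v)"] by simp
  then have "(v, u) \<in> {(x m, y m) | m. True}" unfolding enum using False by simp
  then show thesis using lower False by auto
qed

lemma P_positions_difference:
  fixes x y :: "nat \<Rightarrow> nat"
  assumes "a > 0" "b > 0" "strict_mono x"
    and enum: "{(x m, y m) | m. True} = {(u, v). (u, v) \<in> P_positions a b \<and> u \<le> v}"
  shows "y n = x n + a * n"
proof (induction n rule: less_induct)
  case (less n)
  have P: "(x i, y i) \<in> P_positions a b" "x i \<le> y i" for i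
    using enum by blast+
  have x_less: "x i < x n \<longleftrightarrow> i < n" for i
    using \<open>strict_mono x\<close> by (rule strict_mono_less)
  have ge: "a * n \<le> y n - x n"
  proof (rule ccontr)
    assume lt: "\<not> a * n \<le> y n - x n"
    \<comment> \<open>With this \<open>i\<close>, the two decrements from \<open>(x n, y n)\<close>
      to \<open>(x i, y i)\<close> differ by \<open>d - a * i\<close>, the remainder of
      \<open>d\<close> modulo \<open>a\<close>, so the step is a legal diagonal move.\<close>
    define d i where "d = y n - x n" and "i = d div a"
    have "i < n" unfolding i_def using lt \<open>a > 0\<close>
      by (simp add: d_def less_mult_imp_div_less mult.commute)
    have d: "a * i \<le> d" "d < a * i + a"
      unfolding i_def using \<open>a > 0\<close> mult_div_mod_eq[of a d] mod_less_divisor[of a d] by linarith+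
    have "y n = x n + d" using P(2)[of n] d_def by simp
    moreover have "y i = x i + a * i" "x i < x n"
      using less \<open>i < n\<close> x_less by auto
    ultimately show False
      using P_positions_no_move(1)[OF P(1)[of n] P(1)[of i]] d by linarith
  qed
  show ?case
  proof (rule ccontr)
    assume "y n \<noteq> x n + a * n"
    then have gt: "x n + a * n < y n" using ge P(2)[of n] by linarith
    have "(x n, x n + a * n) \<notin> P_positions a b"
      using P_position_fst_inj[OF \<open>b > 0\<close>] P(1)[of n] gt by fastforce
    then obtain u v where mv: "(u, v) \<in> wyt_moves a b (x n, x n + a * n)"
      and uv: "(u, v) \<in> P_positions a b"
      using P_positions_iff[of "(x n, x n + a * n)"] by fast
    have le: "u \<le> x n" "v \<le> x n + a * n" using mv by (auto simp: wyt_moves_iff)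
    \<comment> \<open>\<open>(u, v)\<close> also lies below the P-position
      \<open>(x n, y n)\<close>, which must have no move to it.\<close>
    have far: "b \<le> x n - u"
      using P_positions_no_move(2)[OF P(1)[of n] uv] gt le by linarith
    \<comment> \<open>The witness is \<open>n - i\<close> for a listed position and
      \<open>n + i\<close> for a mirror image. As the second decrement is the larger one,
      \<open>far\<close> then bounds both from below by \<open>b\<close>, and neither clause of the
      move rule holds.\<close>
    have diff: "\<exists>k. x n + a * n - v = x n - u + a * k \<and> k > 0"
      using enum uv
    proof (cases rule: P_positions_cases)
      case (upper i)
      have "x i \<noteq> x n"
        using upper gt le strict_mono_eq[OF \<open>strict_mono x\<close>] by force
      then have "i < n" using upper le x_less by fastforce
      then have "a * n = a * i + a * (n - i)" by (simp flip: distrib_left)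
      moreover have "y i = x i + a * i" using less \<open>i < n\<close> by simp
      ultimately show ?thesis using upper le \<open>i < n\<close> by (intro exI[of _ "n - i"]) linarith
    next
      case (lower i)
      then have "i < n" using le x_less[of i] by linarith
      then have "y i = x i + a * i" using less by simp
      then show ?thesis using lower le \<open>i < n\<close>
        by (intro exI[of _ "n + i"]) (simp add: distrib_left)
    qed
    then obtain k where k: "x n + a * n - v = x n - u + a * k" "k > 0" by blast
    have "a \<le> a * k" using k(2) by simp
    then show False using mv far k(1) unfolding wyt_moves_iff by linarith
  qed
qed

section \<open>Remoteness along the listing\<close>

theorem mainTheorem13:
  fixes a b :: nat and x y :: "nat \<Rightarrow> nat"
  assumes "a > 0" and "b > 0"
    and "strict_mono x"
    and "{(x m, y m) | m. True} = {(u, v). (u, v) \<in> P_positions a b \<and> u \<le> v}"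
  shows "\<forall>m. remoteness a b (x m, y m) = 2 * m"
proof
  note enum = assms(4)
  have P: "(x i, y i) \<in> P_positions a b" "x i \<le> y i" for i
    using enum by blast+
  have y: "y i = x i + a * i" for i
    using P_positions_difference[OF assms] .
  have x_less: "x i < x j \<longleftrightarrow> i < j" for i j
    using \<open>strict_mono x\<close> by (rule strict_mono_less)
  \<comment> \<open>Moves lower the coordinate sum, and mirroring preserves it, so this bounds the
    index of any P-position reached.\<close>
  have sum_mono: "x i + y i \<le> x j + y j" if "i \<le> j" for i j
    using that x_less[of j i] mult_le_mono2[OF that, of a] y[of i] y[of j] by linarith
  fix m
  show "remoteness a b (x m, y m) = 2 * m"
  proof (induction m rule: less_induct)
    case (less m)
    show ?case
    proof (cases m)
      case 0
      have no: "wyt_moves a b (0, 0) = {}" by (auto simp: wyt_moves_def)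
      then have "(0, 0) \<in> P_positions a b" using P_positions_iff by blast
      then have "(0, 0) \<in> {(x m, y m) | m. True}" unfolding enum by simp
      then obtain j where "x j = 0" by auto
      then have "x 0 = 0" "y 0 = 0" using x_less[of 0 j] y[of 0] by (cases j; simp)+
      then show ?thesis using 0 no by (simp add: remoteness.simps)
    next
      case (Suc k)
      define q where "q = (x k, y k + 1)"
      have xkm: "x k < x m" using x_less Suc by simp
      have q_move: "q \<in> wyt_moves a b (x m, y m)"
        unfolding q_def wyt_moves_iff using xkm y[of k] y[of m] Suc \<open>a > 0\<close>
        by simp
      have q_N: "q \<notin> P_positions a b" using q_move P(1)[of m] P_positions_iff by blast
      have q_to: "wyt_moves a b q \<inter> P_positions a b = {(x k, y k)}"
      proof
        show "{(x k, y k)} \<subseteq> wyt_moves a b q \<inter> P_positions a b"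
          using P(1)[of k] \<open>b > 0\<close> by (auto simp: q_def wyt_moves_iff)
        show "wyt_moves a b q \<inter> P_positions a b \<subseteq> {(x k, y k)}"
        proof clarify
          fix u v assume mv: "(u, v) \<in> wyt_moves a b q" and uv: "(u, v) \<in> P_positions a b"
          have le: "u \<le> x k" "v \<le> y k + 1" using mv by (auto simp: q_def wyt_moves_iff)
          from enum uv show "u = x k \<and> v = y k"
          proof (cases rule: P_positions_cases)
            case (upper i)
            have "i = k"
            proof (rule ccontr)
              assume "i \<noteq> k"
              then have "i < k" using le upper x_less[of k i] by linarith
              then have xi: "x i < x k" and "a * i + a \<le> a * k"
                using x_less mult_le_mono2[of "Suc i" k a] by auto
              \<comment> \<open>The extra unit in the second coordinate of \<open>q\<close> only
                widens the gap between the decrements, so what blocks a move from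
                \<open>(x k, y k)\<close> blocks one from \<open>q\<close>.\<close>
              then have "b \<le> x k - x i"
                using P_positions_no_move(2)[OF P(1)[of k] P(1)[of i]] y[of i] y[of k] by linarith
              with xi \<open>a * i + a \<le> a * k\<close> show False
                using mv upper y[of i] y[of k] unfolding q_def wyt_moves_iff by linarith
            qed
            then show ?thesis using upper by simp
          next
            case (lower i)
            then have "i < k" using le x_less[of i k] by linarith
            then have "a \<le> a * k" by simp
            have "b \<le> x k - u"
              using P_positions_no_move(2)[OF P(1)[of k] uv] lower le P(2)[of k] by linarith
            with \<open>a \<le> a * k\<close> show ?thesis
              using mv lower le y[of k] unfolding q_def wyt_moves_iff by linarith
          qed
        qed
      qed
      have R_q: "remoteness a b q = 2 * k + 1"
        using less[of k] Suc by (simp add: remoteness_N_position[OF q_N] q_to)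
      \<comment> \<open>Any reply to a P-position will do, since \<open>Min\<close> is bounded by
        each of its members; the reply has index below \<open>m\<close>, hence remoteness at most
        \<open>2 * k\<close>.\<close>
      have R_le: "remoteness a b r \<le> 2 * k + 1" if r: "r \<in> wyt_moves a b (x m, y m)" for r
      proof -
        have r_N: "r \<notin> P_positions a b" using r P(1)[of m] P_positions_iff by blast
        then obtain u v where mv: "(u, v) \<in> wyt_moves a b r" and uv: "(u, v) \<in> P_positions a b"
          using P_positions_iff[of r] by fast
        have sum: "u + v < x m + y m"
          using wyt_moves_sum_less[OF mv] wyt_moves_sum_less[OF r] by simp
        obtain i where i: "remoteness a b (u, v) = remoteness a b (x i, y i)" "u + v = x i + y i"
          using enum uv
        proof (cases rule: P_positions_cases)
          case (upper i)
          then show thesis using that by simp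
        next
          case (lower i)
          then show thesis using that[of i] remoteness_swap[of a b "(u, v)"] by simp
        qed
        have "i < m" using sum i(2) sum_mono[of m i] by linarith
        then have "remoteness a b (u, v) \<le> 2 * k" using less i(1) Suc by simp
        moreover have "Min (remoteness a b ` (wyt_moves a b r \<inter> P_positions a b))
            \<le> remoteness a b (u, v)"
          using mv uv finite_wyt_moves[of a b r] by (intro Min_le) auto
        ultimately show ?thesis by (simp add: remoteness_N_position[OF r_N])
      qed
      have "Max (remoteness a b ` wyt_moves a b (x m, y m)) = 2 * k + 1"
        using finite_wyt_moves[of a b "(x m, y m)"] R_le R_q q_move
        by (intro Max_eqI) (auto simp: image_iff intro: bexI[of _ q])
      then show ?thesis
        using remoteness_P_position[OF P(1)[of m]] q_move Suc by auto
    qed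
  qed
qed

end
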